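(* There exists an integral domain which is a PC domain but which is neither pre-Schreier (hence not Bézout) nor a MIP domain.
   Context: All rings are integral domains (commutative with identity). An ideal is two-generated if it equals $(a,b)$ for some elements $a,b$ of the ring. A PC domain is an integral domain in which every proper two-generated ideal is contained in a proper principal ideal. A Bézout domain is an integral domain in which every two-generated ideal is principal. A MIP domain is an integral domain in which every maximal ideal is principal. An element $c$ of an integral domain $D$ is primal if for all $a,b\in D$ with $c\mid ab$ there exist $c_1,c_2\in D$ with $c=c_1c_2$, $c_1\mid a$ and $c_2\mid b$. An integral domain is pre-Schreier if each of its elements is primal. *)

theory Defs
  imports "HOL-Algebra.Algebra"
begin

definition two_generated_ideal :: "'a set \<Rightarrow> ('a, 'b) ring_scheme \<Rightarrow> bool"
  where "two_generated_ideal I R \<longleftrightarrow> (\<exists>a \<in> carrier R. \<exists>b \<in> carrier R. I = Idl\<^bsub>R\<^esub> {a, b})"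

locale pc_domain = "domain" R for R (structure) +
  assumes two_generated_in_proper_principal:
    "\<lbrakk>two_generated_ideal I R; I \<noteq> carrier R\<rbrakk>
      \<Longrightarrow> \<exists>J. principalideal J R \<and> J \<noteq> carrier R \<and> I \<subseteq> J"

locale bezout_domain = "domain" R for R (structure) +
  assumes two_generated_principal: "two_generated_ideal I R \<Longrightarrow> principalideal I R"

locale mip_domain = "domain" R for R (structure) +
  assumes maximal_principal: "maximalideal M R \<Longrightarrow> principalideal M R"

definition primal :: "('a, 'b) ring_scheme \<Rightarrow> 'a \<Rightarrow> bool"
  where "primal R c \<longleftrightarrow>
    (\<forall>a \<in> carrier R. \<forall>b \<in> carrier R. c divides\<^bsub>R\<^esub> (a \<otimes>\<^bsub>R\<^esub> b) \<longrightarrow>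
      (\<exists>c1 \<in> carrier R. \<exists>c2 \<in> carrier R.
        c = c1 \<otimes>\<^bsub>R\<^esub> c2 \<and> c1 divides\<^bsub>R\<^esub> a \<and> c2 divides\<^bsub>R\<^esub> b))"

locale pre_schreier_domain = "domain" R for R (structure) +
  assumes all_primal: "c \<in> carrier R \<Longrightarrow> primal R c"

end

(*
  Let A be a PC domain with a nonprincipal maximal ideal M, contained in a field L, and let R be
  the ring of the power series over L with constant term in A. A nonzero nonunit m of A divides
  every power series without constant term in R, so the PC property passes from A to R; the power
  series with constant term in M form a nonprincipal maximal ideal of R. If l in L is not a
  quotient of elements of A, then X divides (l X) (X / l) in R, but X is not primal, and (X, l X)
  is not principal.

  We take L to be the complex numbers, l = i, and A the union of the rings Q[u_n], where
  u_n = exp (t / 2 ^ n) and the real t is such that all u_n are transcendental. Then A is a union of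
  principal ideal domains, hence PC, and the square root u_(n+1) of u_n shows that the ideal
  generated by all u_n is not principal.
*)
theory Submission
  imports
    Defs
    "HOL-Computational_Algebra.Formal_Power_Series"
    "HOL-Computational_Algebra.Field_as_Ring"
    "HOL-Computational_Algebra.Polynomial_Factorial"
    "HOL-Analysis.Continuum_Not_Denumerable"
begin

(* The ring of power series with constant term in A, transported along an injection \<phi>. *)
definition pullback_ring :: "('a::field fps \<Rightarrow> 'b) \<Rightarrow> 'a set \<Rightarrow> 'b ring" where
  "pullback_ring \<phi> A =
    \<lparr>carrier = \<phi> ` {f. fps_nth f 0 \<in> A},
     monoid.mult = (\<lambda>x y. \<phi> (inv_into UNIV \<phi> x * inv_into UNIV \<phi> y)), monoid.one = \<phi> 1,
     ring.zero = \<phi> 0, ring.add = (\<lambda>x y. \<phi> (inv_into UNIV \<phi> x + inv_into UNIV \<phi> y))\<rparr>"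

section \<open>Ring structure, divisibility and ideals of the power series ring\<close>

locale pullback =
  fixes \<phi> :: "'a::field fps \<Rightarrow> 'b" and A :: "'a set"
  assumes inj: "inj \<phi>"
    and one_A: "1 \<in> A"
    and diff_A: "a \<in> A \<Longrightarrow> b \<in> A \<Longrightarrow> a - b \<in> A"
    and mult_A: "a \<in> A \<Longrightarrow> b \<in> A \<Longrightarrow> a * b \<in> A"
begin

abbreviation R where "R \<equiv> pullback_ring \<phi> A"

lemma zero_A: "0 \<in> A"
  using diff_A[OF one_A one_A] by simp

lemma uminus_A: "a \<in> A \<Longrightarrow> - a \<in> A"
  using diff_A[OF zero_A] by fastforce

lemma add_A: "a \<in> A \<Longrightarrow> b \<in> A \<Longrightarrow> a + b \<in> A"
  using diff_A[of a "- b"] uminus_A by simp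

lemma R_simps [simp]:
  "x \<in> carrier R \<longleftrightarrow> (\<exists>f. x = \<phi> f \<and> fps_nth f 0 \<in> A)"
  "\<phi> f \<otimes>\<^bsub>R\<^esub> \<phi> g = \<phi> (f * g)"
  "\<phi> f \<oplus>\<^bsub>R\<^esub> \<phi> g = \<phi> (f + g)"
  "\<one>\<^bsub>R\<^esub> = \<phi> 1" "\<zero>\<^bsub>R\<^esub> = \<phi> 0"
  using inj by (auto simp: pullback_ring_def)

lemma \<phi>_eq [simp]: "\<phi> f = \<phi> g \<longleftrightarrow> f = g"
  using inj by (simp add: inj_eq)

lemma bex_carrier: "(\<exists>x\<in>carrier R. P x) \<longleftrightarrow> (\<exists>f. fps_nth f 0 \<in> A \<and> P (\<phi> f))"
  by auto

lemma domain_R: "domain R"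
proof (rule domain.intro)
  have "\<exists>y\<in>carrier R. y \<oplus>\<^bsub>R\<^esub> x = \<zero>\<^bsub>R\<^esub>" if x: "x \<in> carrier R" for x
  proof -
    obtain f where "x = \<phi> f" "fps_nth f 0 \<in> A"
      using x by auto
    then show ?thesis
      using uminus_A by (intro bexI[of _ "\<phi> (- f)"]) auto
  qed
  then show "cring R"
    by (intro cringI abelian_groupI comm_monoidI)
      (auto simp: one_A zero_A add_A mult_A algebra_simps)
  show "domain_axioms R"
    by unfold_locales auto
qed

sublocale domain R
  by (rule domain_R)

lemma divides_iff:
  "\<phi> f divides\<^bsub>R\<^esub> \<phi> g \<longleftrightarrow> (\<exists>h. fps_nth h 0 \<in> A \<and> g = f * h)"
  unfolding factor_def by (simp add: bex_carrier del: R_simps(1))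

lemma PIdl_iff:
  "fps_nth f 0 \<in> A \<Longrightarrow> \<phi> g \<in> PIdl\<^bsub>R\<^esub> (\<phi> f) \<longleftrightarrow> (\<exists>h. fps_nth h 0 \<in> A \<and> g = f * h)"
  unfolding cgenideal_def by (force simp: mult.commute)

lemma principalideal_iff:
  "principalideal J R \<longleftrightarrow> (\<exists>f. fps_nth f 0 \<in> A \<and> J = PIdl\<^bsub>R\<^esub> (\<phi> f))"
proof
  assume "principalideal J R"
  then show "\<exists>f. fps_nth f 0 \<in> A \<and> J = PIdl\<^bsub>R\<^esub> (\<phi> f)"
    using principalideal.generate[of J R] cgenideal_eq_genideal
    by (simp add: bex_carrier del: R_simps(1)) (metis R_simps(1))
qed (auto intro!: cgenideal_is_principalideal)

text \<open>Taking constant terms is a ring homomorphism onto \<open>A\<close>, and preimages of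
  ideals are ideals. It is applied to a maximal ideal of \<open>A\<close> and to the zero
  ideal.\<close>

lemma constant_term_ideal:
  assumes sub: "N \<subseteq> A" and zero: "0 \<in> N"
    and diff: "\<And>a b. a \<in> N \<Longrightarrow> b \<in> N \<Longrightarrow> a - b \<in> N"
    and mult: "\<And>a b. a \<in> A \<Longrightarrow> b \<in> N \<Longrightarrow> a * b \<in> N"
  shows "ideal (\<phi> ` {f. fps_nth f 0 \<in> N}) R" (is "ideal ?J R")
proof -
  have neg: "- a \<in> N" if "a \<in> N" for a
    using diff[OF zero that] by simp
  have add: "a + b \<in> N" if "a \<in> N" "b \<in> N" for a b
    using diff[OF that(1) neg[OF that(2)]] by simp
  have minus: "\<ominus>\<^bsub>R\<^esub> \<phi> f = \<phi> (- f)" if "fps_nth f 0 \<in> N" for f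
    using that sub neg by (intro minus_equality) auto
  have "subgroup ?J (add_monoid R)"
  proof (rule add.subgroupI)
    show "?J \<subseteq> carrier R" using sub by auto
    show "?J \<noteq> {}" using zero by (auto intro!: exI[of _ 0])
    show "\<And>a. a \<in> ?J \<Longrightarrow> \<ominus>\<^bsub>R\<^esub> a \<in> ?J" using minus neg by auto
    show "\<And>a b. a \<in> ?J \<Longrightarrow> b \<in> ?J \<Longrightarrow> a \<oplus>\<^bsub>R\<^esub> b \<in> ?J" using add by auto
  qed
  moreover have "x \<otimes>\<^bsub>R\<^esub> a \<in> ?J \<and> a \<otimes>\<^bsub>R\<^esub> x \<in> ?J" if "a \<in> ?J" "x \<in> carrier R" for a x
    using that mult by (auto intro!: imageI) (metis mult.commute)
  ultimately show ?thesis
    by (intro idealI ring_axioms) auto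
qed

section \<open>Transfer of the PC property\<close>

text \<open>The constant terms of two generators decide. If they generate \<open>A\<close>, the
  ideal contains a series with constant term 1, hence a unit; otherwise their common nonunit divisor
  \<open>m\<close>, viewed as a constant series, divides both generators.\<close>

lemma pc_domain_R:
  assumes pc: "\<And>a b. a \<in> A \<Longrightarrow> b \<in> A \<Longrightarrow>
      (\<exists>x\<in>A. \<exists>y\<in>A. a * x + b * y = 1) \<or>
      (\<exists>m\<in>A. m \<noteq> 0 \<and> inverse m \<notin> A \<and> (\<exists>u\<in>A. a = m * u) \<and> (\<exists>v\<in>A. b = m * v))"
  shows "pc_domain R"
proof unfold_locales
  fix I
  assume "two_generated_ideal I R" and proper: "I \<noteq> carrier R"
  then obtain f g where f: "fps_nth f 0 \<in> A" and g: "fps_nth g 0 \<in> A"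
    and I: "I = Idl\<^bsub>R\<^esub> {\<phi> f, \<phi> g}"
    unfolding two_generated_ideal_def bex_carrier by blast
  interpret I: ideal I R
    unfolding I using f g by (intro genideal_ideal) auto
  have in_I: "\<phi> f \<in> I" "\<phi> g \<in> I"
    using genideal_self[of "{\<phi> f, \<phi> g}"] f g unfolding I by auto
  have "\<not> (\<exists>x\<in>A. \<exists>y\<in>A. fps_nth f 0 * x + fps_nth g 0 * y = 1)"
  proof clarify
    fix x y
    assume xy: "x \<in> A" "y \<in> A" "fps_nth f 0 * x + fps_nth g 0 * y = 1"
    define h where "h = f * fps_const x + g * fps_const y"
    have h0: "fps_nth h 0 = 1"
      using xy by (simp add: h_def)
    have "\<phi> f \<otimes>\<^bsub>R\<^esub> \<phi> (fps_const x) \<oplus>\<^bsub>R\<^esub> \<phi> g \<otimes>\<^bsub>R\<^esub> \<phi> (fps_const y) \<in> I"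
      using in_I xy by (intro I.a_closed I.I_r_closed) auto
    then have "\<phi> h \<in> I"
      by (simp add: h_def)
    \<comment> \<open>The inverse series of \<open>h\<close> again has constant term 1, so it lies
      in the ring.\<close>
    then have "\<phi> h \<otimes>\<^bsub>R\<^esub> \<phi> (inverse h) \<in> I"
      using h0 one_A by (intro I.I_r_closed) auto
    then have "\<one>\<^bsub>R\<^esub> \<in> I"
      using h0 by (simp add: inverse_mult_eq_1')
    then show False
      using proper I.one_imp_carrier by blast
  qed
  then obtain m u v where m: "m \<in> A" "m \<noteq> 0" "inverse m \<notin> A"
    and u: "u \<in> A" "fps_nth f 0 = m * u" and v: "v \<in> A" "fps_nth g 0 = m * v"
    using pc[OF f g] by blast
  define J where "J = PIdl\<^bsub>R\<^esub> (\<phi> (fps_const m))"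
  \<comment> \<open>All coefficients of \<open>h / m\<close> lie in the field and the higher ones
    are unrestricted, so only the constant term matters. This is why \<open>m\<close> must be
    nonzero.\<close>
  have J_iff: "\<phi> h \<in> J \<longleftrightarrow> fps_nth h 0 / m \<in> A" for h
  proof -
    have "h = fps_const m * k \<longleftrightarrow> k = fps_const (inverse m) * h" for k
      using m(2) by (auto simp: mult.assoc[symmetric])
    then show ?thesis
      using m by (simp add: J_def PIdl_iff field_simps)
  qed
  have princ: "principalideal J R"
    unfolding J_def using m by (intro cgenideal_is_principalideal) auto
  have "\<one>\<^bsub>R\<^esub> \<notin> J"
    using J_iff[of 1] m by (simp add: inverse_eq_divide)
  moreover have "{\<phi> f, \<phi> g} \<subseteq> J"
    using J_iff m u v by simp
  then have "I \<subseteq> J"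
    unfolding I using princ by (intro genideal_minimal principalideal.axioms(1)) auto
  ultimately show "\<exists>J. principalideal J R \<and> J \<noteq> carrier R \<and> I \<subseteq> J"
    using princ one_closed by blast
qed

section \<open>Failure of the pre-Schreier and Bezout properties\<close>

context
  fixes l :: 'a
  assumes not_quotient: "\<And>a b. a \<in> A \<Longrightarrow> b \<in> A \<Longrightarrow> b \<noteq> 0 \<Longrightarrow> l \<noteq> a / b"
begin

text \<open>With \<open>F c\<close> the series c X, X divides \<open>F l * F (inverse l)\<close>,
  which is X squared. If X = f g with f dividing l X and g dividing X / l, then f or g has no
  constant term, and comparing coefficients of X writes \<open>l\<close> as a quotient of constant
  terms, which lie in \<open>A\<close>.\<close>

lemma not_pre_schreier_R: "\<not> pre_schreier_domain R"
proof
  define F where "F c = fps_const c * fps_X" for c :: 'a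
  have l: "l \<noteq> 0"
    using not_quotient[of 0 1] zero_A one_A by auto
  assume "pre_schreier_domain R"
  then have primal: "primal R (\<phi> fps_X)"
    by (rule pre_schreier_domain.all_primal) (auto simp: zero_A)
  have "F l * F (inverse l) = fps_const (l * inverse l) * (fps_X * fps_X)"
    by (simp add: F_def mult_ac flip: fps_const_mult)
  then have "F l * F (inverse l) = fps_X * fps_X"
    using l by simp
  then have "\<phi> fps_X divides\<^bsub>R\<^esub> (\<phi> (F l) \<otimes>\<^bsub>R\<^esub> \<phi> (F (inverse l)))"
    by (auto simp: divides_iff zero_A intro!: exI[of _ fps_X])
  then have "\<exists>c\<in>carrier R. \<exists>d\<in>carrier R. \<phi> fps_X = c \<otimes>\<^bsub>R\<^esub> d \<and>
      c divides\<^bsub>R\<^esub> \<phi> (F l) \<and> d divides\<^bsub>R\<^esub> \<phi> (F (inverse l))"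
    by (intro primal[unfolded primal_def, rule_format]) (simp_all add: F_def zero_A)
  then obtain f g h k where f: "fps_nth f 0 \<in> A" and g: "fps_nth g 0 \<in> A"
    and X: "fps_X = f * g"
    and h: "fps_nth h 0 \<in> A" "F l = f * h" and k: "fps_nth k 0 \<in> A" "F (inverse l) = g * k"
    unfolding bex_carrier by (auto simp: divides_iff)
  have eqs: "fps_nth f 0 * fps_nth g 0 = 0" "fps_nth f 0 * fps_nth g 1 + fps_nth f 1 * fps_nth g 0 = 1"
    "fps_nth f 0 * fps_nth h 1 + fps_nth f 1 * fps_nth h 0 = l"
    "fps_nth g 0 * fps_nth k 1 + fps_nth g 1 * fps_nth k 0 = inverse l"
    using arg_cong[OF X, of "\<lambda>f. fps_nth f 0"] arg_cong[OF X, of "\<lambda>f. fps_nth f 1"]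
      arg_cong[OF h(2), of "\<lambda>f. fps_nth f 1"] arg_cong[OF k(2), of "\<lambda>f. fps_nth f 1"]
    by (simp_all add: F_def fps_mult_nth_1)
  show False
  proof (cases "fps_nth f 0 = 0")
    case True
    \<comment> \<open>Here f1 g0 = 1 and f1 h0 = l, where indices denote coefficients; eliminating
      f1, which need not lie in \<open>A\<close>, leaves l g0 = h0.\<close>
    then have "l * fps_nth g 0 = fps_nth h 0" "fps_nth g 0 \<noteq> 0"
      using eqs by (algebra, auto)
    then have "l = fps_nth h 0 / fps_nth g 0" "fps_nth g 0 \<noteq> 0"
      by (auto simp: field_simps)
    then show ?thesis
      using not_quotient h(1) g by blast
  next
    case False
    then have "fps_nth g 0 = 0"
      using eqs(1) by simp
    \<comment> \<open>Symmetrically, g1 is now the coefficient to be eliminated.\<close>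
    then have "fps_nth f 0 * fps_nth g 1 = 1" "fps_nth g 1 * fps_nth k 0 = inverse l"
      using eqs by simp_all
    then have "fps_nth f 0 * inverse l = fps_nth k 0"
      by (metis mult.assoc mult_1)
    then have "fps_nth f 0 = l * fps_nth k 0"
      using l by (auto simp: field_simps)
    then have "l = fps_nth f 0 / fps_nth k 0" "fps_nth k 0 \<noteq> 0"
      using False by (auto simp: field_simps)
    then show ?thesis
      using not_quotient k(1) f by blast
  qed
qed

text \<open>A generator f of (X, l X) has no constant term. Writing X = f h and l X = f k, the
  coefficients of X give f1 h0 = 1 and f1 k0 = l, so again l = k0 / h0.\<close>

lemma not_bezout_R: "\<not> bezout_domain R"
proof
  define Y where "Y = fps_const l * fps_X"
  define I where "I = Idl\<^bsub>R\<^esub> {\<phi> fps_X, \<phi> Y}"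
  have XY: "\<phi> fps_X \<in> carrier R" "\<phi> Y \<in> carrier R"
    by (simp_all add: Y_def zero_A)
  assume "bezout_domain R"
  then have "principalideal I R"
    by (rule bezout_domain.two_generated_principal)
      (use XY in \<open>unfold two_generated_ideal_def I_def, blast\<close>)
  then obtain f where f: "fps_nth f 0 \<in> A" and I: "I = PIdl\<^bsub>R\<^esub> (\<phi> f)"
    by (auto simp: principalideal_iff)
  have "I \<subseteq> \<phi> ` {f. fps_nth f 0 \<in> {0}}"
    unfolding I_def using zero_A
    by (intro genideal_minimal constant_term_ideal) (auto simp: Y_def)
  moreover have "\<phi> f \<in> I"
    using f by (auto simp: I intro!: cgenideal_self)
  ultimately have f0: "fps_nth f 0 = 0"
    by auto
  have "\<phi> fps_X \<in> I" "\<phi> Y \<in> I"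
    using genideal_self[of "{\<phi> fps_X, \<phi> Y}"] XY by (auto simp: I_def)
  then obtain h k where h: "fps_nth h 0 \<in> A" "fps_X = f * h" and k: "fps_nth k 0 \<in> A" "Y = f * k"
    using f by (auto simp: I PIdl_iff)
  have "fps_nth f 1 * fps_nth h 0 = 1" "fps_nth f 1 * fps_nth k 0 = l"
    using arg_cong[OF h(2), of "\<lambda>f. fps_nth f 1"] arg_cong[OF k(2), of "\<lambda>f. fps_nth f 1"] f0
    by (simp_all add: fps_mult_nth_1 Y_def)
  then have "l * fps_nth h 0 = fps_nth k 0" "fps_nth h 0 \<noteq> 0"
    by (algebra, auto)
  then have "l = fps_nth k 0 / fps_nth h 0" "fps_nth h 0 \<noteq> 0"
    by (auto simp: field_simps)
  then show False
    using not_quotient h(1) k(1) by blast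
qed

end

section \<open>A nonprincipal maximal ideal\<close>

text \<open>The preimage of \<open>M\<close> under the constant term map inherits both properties of
  \<open>M\<close>: it is maximal because nonzero classes modulo \<open>M\<close> are invertible,
  and the constant term of a generator would generate \<open>M\<close> in \<open>A\<close>.\<close>

lemma not_mip_R:
  assumes sub: "M \<subseteq> A" and zero: "0 \<in> M" and one: "1 \<notin> M"
    and diff: "\<And>a b. a \<in> M \<Longrightarrow> b \<in> M \<Longrightarrow> a - b \<in> M"
    and mult: "\<And>a b. a \<in> A \<Longrightarrow> b \<in> M \<Longrightarrow> a * b \<in> M"
    and inverse_mod: "\<And>a. a \<in> A \<Longrightarrow> a \<notin> M \<Longrightarrow> \<exists>b\<in>A. 1 - a * b \<in> M"
    and not_principal: "\<And>g. g \<in> M \<Longrightarrow> \<exists>m\<in>M. \<forall>d\<in>A. m \<noteq> g * d"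
  shows "\<not> mip_domain R"
proof
  define N where "N = \<phi> ` {f. fps_nth f 0 \<in> M}"
  have N_iff: "\<phi> f \<in> N \<longleftrightarrow> fps_nth f 0 \<in> M" for f
    by (auto simp: N_def)
  have "maximalideal N R"
  proof (rule maximalidealI)
    show "ideal N R"
      unfolding N_def by (rule constant_term_ideal) (fact sub zero diff mult)+
    have "\<one>\<^bsub>R\<^esub> \<notin> N"
      using one by (simp add: N_iff)
    then show "carrier R \<noteq> N"
      using one_closed by blast
    fix J
    assume J: "ideal J R" "N \<subseteq> J" "J \<subseteq> carrier R"
    interpret J: ideal J R by fact
    show "J = N \<or> J = carrier R"
    proof (rule disjCI)
      assume "J \<noteq> carrier R"
      show "J = N"
      proof (rule ccontr)
        assume "J \<noteq> N"
        then obtain f where f: "\<phi> f \<in> J" "fps_nth f 0 \<in> A" "fps_nth f 0 \<notin> M"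
          using J N_iff by (metis R_simps(1) subsetD subsetI subset_antisym)
        then obtain b where b: "b \<in> A" "1 - fps_nth f 0 * b \<in> M"
          using inverse_mod by blast
        \<comment> \<open>This sum is 1: its first summand is a multiple of \<open>f\<close>, and
          the second has constant term in \<open>M\<close>.\<close>
        have "\<phi> f \<otimes>\<^bsub>R\<^esub> \<phi> (fps_const b) \<oplus>\<^bsub>R\<^esub> \<phi> (1 - f * fps_const b) \<in> J"
          using b f J(2) by (intro J.a_closed J.I_r_closed) (auto simp: N_iff subset_iff)
        then have "\<one>\<^bsub>R\<^esub> \<in> J"
          by simp
        then show False
          using \<open>J \<noteq> carrier R\<close> J.one_imp_carrier by blast
      qed
    qed
  qed
  moreover assume "mip_domain R"
  ultimately have "principalideal N R"
    by (intro mip_domain.maximal_principal)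
  then obtain f where f: "fps_nth f 0 \<in> A" and N: "N = PIdl\<^bsub>R\<^esub> (\<phi> f)"
    by (auto simp: principalideal_iff)
  have "\<phi> f \<in> N"
    using f by (auto simp: N intro!: cgenideal_self)
  then obtain m where m: "m \<in> M" "\<forall>d\<in>A. m \<noteq> fps_nth f 0 * d"
    using not_principal by (auto simp: N_iff)
  then have "\<phi> (fps_const m) \<in> PIdl\<^bsub>R\<^esub> (\<phi> f)"
    unfolding N[symmetric] by (simp add: N_iff)
  then obtain h where "fps_nth h 0 \<in> A" "fps_const m = f * h"
    using f by (auto simp: PIdl_iff)
  then show False
    using m(2) by (metis fps_mult_nth_0 fps_nth_fps_const)
qed

end

section \<open>Evaluation of rational polynomials\<close>

text \<open>The image of \<open>rat_eval\<close> at x is the subring Q[x]. Keeping the polynomials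
  in \<open>rat poly\<close> makes gcds and Bezout coefficients available.\<close>

definition rat_eval :: "rat poly \<Rightarrow> 'a::field_char_0 \<Rightarrow> 'a" where
  "rat_eval p x = Polynomial.poly (map_poly of_rat p) x"

lemma rat_eval_pCons [simp]: "rat_eval (pCons a p) x = of_rat a + x * rat_eval p x"
  by (simp add: rat_eval_def map_poly_pCons)

lemma rat_eval_0 [simp]: "rat_eval 0 x = 0"
  by (simp add: rat_eval_def)

lemma rat_eval_1 [simp]: "rat_eval 1 x = 1"
  by (simp add: rat_eval_def)

lemma rat_eval_add [simp]: "rat_eval (p + q) x = rat_eval p x + rat_eval q x"
  by (induction p q rule: poly_induct2) (simp_all add: of_rat_add algebra_simps)

lemma rat_eval_smult [simp]: "rat_eval (Polynomial.smult c p) x = of_rat c * rat_eval p x"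
  by (induction p) (simp_all add: of_rat_mult algebra_simps)

lemma rat_eval_mult [simp]: "rat_eval (p * q) x = rat_eval p x * rat_eval q x"
  by (induction p) (simp_all add: algebra_simps)

lemma rat_eval_diff [simp]: "rat_eval (p - q) x = rat_eval p x - rat_eval q x"
  using rat_eval_add[of "p - q" q x] by (simp add: algebra_simps)

lemma rat_eval_power [simp]: "rat_eval (p ^ n) x = rat_eval p x ^ n"
  by (induction n) simp_all

lemma rat_eval_pcompose [simp]: "rat_eval (pcompose p q) x = rat_eval p (rat_eval q x)"
  by (induction p) (simp_all add: pcompose_pCons)

lemma of_rat_in_Reals: "(of_rat a :: 'a::real_field) \<in> \<real>"
  by (cases a) (simp add: of_rat_rat Reals_divide)

lemma rat_eval_Reals:
  fixes x :: "'a::real_field"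
  shows "x \<in> \<real> \<Longrightarrow> rat_eval p x \<in> \<real>"
  by (induction p) (auto intro: Reals_add Reals_mult of_rat_in_Reals)

lemma degree_X_power: "Polynomial.degree ([:0, 1:] ^ n :: 'a::idom poly) = n"
  by (simp add: degree_power_eq)

section \<open>The union of the polynomial rings along a tower of square roots\<close>

locale square_root_tower =
  fixes s :: "nat \<Rightarrow> 'a::field_char_0"
  assumes square: "s (Suc n) ^ 2 = s n"
    and transcendental: "rat_eval p (s n) = 0 \<Longrightarrow> p = 0"
begin

definition A :: "'a set" where "A = {rat_eval p (s n) | p n. True}"
text \<open>This is the ideal of \<open>A\<close> generated by all \<open>s n\<close>.\<close>

definition M :: "'a set" where "M = {rat_eval p (s n) | p n. Polynomial.coeff p 0 = 0}"

lemma A_I [intro]: "rat_eval p (s n) \<in> A"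
  by (auto simp: A_def)

lemma M_I: "Polynomial.coeff p 0 = 0 \<Longrightarrow> rat_eval p (s n) \<in> M"
  by (auto simp: M_def)

lemma rat_eval_eq_iff: "rat_eval p (s n) = rat_eval q (s n) \<longleftrightarrow> p = q"
  using transcendental[of "p - q" n] by auto

lemma power_s: "s (n + k) ^ 2 ^ k = s n"
proof (induction k)
  case (Suc k)
  have "s (n + Suc k) ^ 2 ^ Suc k = (s (Suc (n + k)) ^ 2) ^ 2 ^ k"
    by (simp flip: power_mult)
  then show ?case
    using Suc by (simp add: square)
qed simp

text \<open>By \<open>power_s\<close>, the inclusion of Q[\<open>s n\<close>] in
  Q[\<open>s (n + k)\<close>] is the substitution of x^(2^k) for x.\<close>

definition lift :: "nat \<Rightarrow> rat poly \<Rightarrow> rat poly" where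
  "lift k p = pcompose p ([:0, 1:] ^ 2 ^ k)"

lemma rat_eval_lift [simp]: "rat_eval (lift k p) (s (n + k)) = rat_eval p (s n)"
  by (simp add: lift_def power_s)

text \<open>With both orders of the sum, elements of levels m and n can be rewritten together at
  level m + n.\<close>

lemma rat_eval_lift' [simp]: "rat_eval (lift k p) (s (k + n)) = rat_eval p (s n)"
  using rat_eval_lift[of k p n] by (simp only: add.commute)

lemma coeff_0_lift [simp]: "Polynomial.coeff (lift k p) 0 = Polynomial.coeff p 0"
  by (simp add: lift_def coeff_0_power poly_0_coeff_0 power_0_left)

lemma degree_lift: "Polynomial.degree (lift k p) = Polynomial.degree p * 2 ^ k"
  by (simp add: lift_def degree_pcompose degree_X_power)

lemma common_level:
  assumes "a \<in> A" "b \<in> A"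
  obtains p q n where "a = rat_eval p (s n)" "b = rat_eval q (s n)"
proof -
  obtain p m q n where "a = rat_eval p (s m)" "b = rat_eval q (s n)"
    using assms by (auto simp: A_def)
  then show thesis
    using that[of "lift n p" "m + n" "lift m q"] by simp
qed

text \<open>Membership does not depend on the representation: at a common level, transcendence makes
  two representing polynomials equal, and \<open>lift\<close> preserves constant
  coefficients.\<close>

lemma mem_M_iff: "rat_eval p (s n) \<in> M \<longleftrightarrow> Polynomial.coeff p 0 = 0"
proof
  assume "rat_eval p (s n) \<in> M"
  then obtain q m where q: "rat_eval p (s n) = rat_eval q (s m)" "Polynomial.coeff q 0 = 0"
    by (auto simp: M_def)
  then have "rat_eval (lift m p) (s (n + m)) = rat_eval (lift n q) (s (n + m))"
    by simp
  then have "lift m p = lift n q"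
    by (simp only: rat_eval_eq_iff)
  then show "Polynomial.coeff p 0 = 0"
    using q coeff_0_lift by metis
qed (rule M_I)

lemma M_subset: "M \<subseteq> A"
  by (auto simp: M_def)

lemma const_A: "of_rat c \<in> A"
  using A_I[of "[:c:]"] by simp

lemma A_diff: "a \<in> A \<Longrightarrow> b \<in> A \<Longrightarrow> a - b \<in> A"
  by (erule (1) common_level) (simp flip: rat_eval_diff add: A_I)

lemma A_mult: "a \<in> A \<Longrightarrow> b \<in> A \<Longrightarrow> a * b \<in> A"
  by (erule (1) common_level) (simp flip: rat_eval_mult add: A_I)

lemma M_diff:
  assumes "a \<in> M" "b \<in> M"
  shows "a - b \<in> M"
proof -
  have "a \<in> A" "b \<in> A"
    using assms M_subset by auto
  then obtain p q n where "a = rat_eval p (s n)" "b = rat_eval q (s n)"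
    by (rule common_level)
  then show ?thesis
    using assms by (simp flip: rat_eval_diff add: mem_M_iff)
qed

lemma M_mult:
  assumes "a \<in> A" "b \<in> M"
  shows "a * b \<in> M"
proof -
  have "a \<in> A" "b \<in> A"
    using assms M_subset by auto
  then obtain p q n where "a = rat_eval p (s n)" "b = rat_eval q (s n)"
    by (rule common_level)
  then show ?thesis
    using assms by (simp flip: rat_eval_mult add: mem_M_iff coeff_mult)
qed

lemma one_notin_M: "1 \<notin> M"
  using mem_M_iff[of 1 0] by simp

lemma zero_in_M: "0 \<in> M"
  using mem_M_iff[of 0 0] by simp

text \<open>Modulo \<open>M\<close>, each element of \<open>A\<close> is congruent to its constant
  coefficient, a rational number, which is nonzero outside \<open>M\<close>.\<close>

lemma M_inverse_mod:
  assumes "a \<in> A" "a \<notin> M"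
  shows "\<exists>b\<in>A. 1 - a * b \<in> M"
proof -
  obtain p n where a: "a = rat_eval p (s n)"
    using assms by (auto simp: A_def)
  define c where "c = Polynomial.coeff p 0"
  have "c \<noteq> 0"
    using assms by (simp add: a mem_M_iff c_def)
  moreover have eq: "1 - a * of_rat (inverse c) = rat_eval (1 - Polynomial.smult (inverse c) p) (s n)"
    by (simp add: a)
  ultimately have "1 - a * of_rat (inverse c) \<in> M"
    unfolding eq mem_M_iff by (simp add: c_def)
  then show ?thesis
    using const_A by blast
qed

text \<open>For g = p(\<open>s n\<close>), the witness is the square root \<open>s (Suc n)\<close>.
  If it were a multiple of g, then at a high level x^(2^k) would be a multiple of p(x^(2^(k+1))),
  whose degree is too large, as p is nonconstant.\<close>

lemma M_not_principal:
  assumes "g \<in> M"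
  shows "\<exists>m\<in>M. \<forall>d\<in>A. m \<noteq> g * d"
proof -
  obtain p n where g: "g = rat_eval p (s n)" "Polynomial.coeff p 0 = 0"
    using assms by (auto simp: M_def)
  have "s (Suc n) \<noteq> g * d" if dA: "d \<in> A" for d
  proof
    assume eq: "s (Suc n) = g * d"
    obtain q k where d: "d = rat_eval q (s k)"
      using dA by (auto simp: A_def)
    \<comment> \<open>The elements \<open>s (Suc n)\<close>, \<open>g\<close> and \<open>d\<close>
      have levels n + 1, n and k; lifting by k, k + 1 and n + 1 brings them to this level.\<close>
    let ?N = "Suc n + k"
    have "s (Suc n) = rat_eval (lift k [:0, 1:]) (s ?N)"
      by (simp only: rat_eval_lift) simp
    moreover have "g = rat_eval (lift (Suc k) p) (s ?N)"
      using rat_eval_lift[of "Suc k" p n] by (simp add: g)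
    moreover have "d = rat_eval (lift (Suc n) q) (s ?N)"
      by (simp only: rat_eval_lift' d)
    ultimately have "rat_eval (lift k [:0, 1:]) (s ?N) = rat_eval (lift (Suc k) p * lift (Suc n) q) (s ?N)"
      using eq by (simp only: rat_eval_mult)
    then have lift: "lift k [:0, 1:] = lift (Suc k) p * lift (Suc n) q"
      by (simp only: rat_eval_eq_iff)
    have "lift k [:0, 1:] \<noteq> 0"
      using degree_lift[of k "[:0, 1:]"] by auto
    with lift have "p \<noteq> 0" and "Polynomial.degree (lift (Suc k) p) \<le> Polynomial.degree (lift k [:0, 1:])"
      by (auto simp: lift_def degree_mult_eq)
    moreover have "Polynomial.degree p \<noteq> 0"
      using g(2) \<open>p \<noteq> 0\<close> by (metis leading_coeff_0_iff)
    ultimately show False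
      by (simp add: degree_lift)
  qed
  moreover have "s (Suc n) \<in> M"
    using M_I[of "[:0, 1:]" "Suc n"] by simp
  ultimately show ?thesis
    by blast
qed

text \<open>Lifting multiplies degrees by a power of 2, so a nonconstant polynomial becomes a unit
  at no level.\<close>

lemma inverse_notin_A:
  assumes "Polynomial.degree p \<noteq> 0"
  shows "inverse (rat_eval p (s n)) \<notin> A"
proof
  assume "inverse (rat_eval p (s n)) \<in> A"
  then obtain q k where q: "inverse (rat_eval p (s n)) = rat_eval q (s k)"
    by (auto simp: A_def)
  have "rat_eval p (s n) \<noteq> 0"
    using assms transcendental degree_0 by metis
  then have "1 = rat_eval p (s n) * rat_eval q (s k)"
    by (simp flip: q)
  also have "\<dots> = rat_eval (lift k p * lift n q) (s (n + k))"
    by simp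
  finally have "rat_eval 1 (s (n + k)) = rat_eval (lift k p * lift n q) (s (n + k))"
    by simp
  then have "1 = lift k p * lift n q"
    by (simp only: rat_eval_eq_iff)
  then have "lift k p dvd 1"
    by (rule dvdI)
  then have "Polynomial.degree (lift k p) = 0"
    by (metis is_unit_iff_degree not_is_unit_0)
  then show False
    using assms by (simp add: degree_lift)
qed

text \<open>Both elements lie in one Q[\<open>s n\<close>], a principal ideal domain: coprime
  polynomials have a Bezout identity, and a nonconstant common divisor stays a nonunit in
  \<open>A\<close> by \<open>inverse_notin_A\<close>.\<close>

lemma A_two_generated:
  assumes "a \<in> A" "b \<in> A"
  shows "(\<exists>x\<in>A. \<exists>y\<in>A. a * x + b * y = 1) \<or>
    (\<exists>m\<in>A. m \<noteq> 0 \<and> inverse m \<notin> A \<and> (\<exists>u\<in>A. a = m * u) \<and> (\<exists>v\<in>A. b = m * v))"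
proof -
  obtain p q n where a: "a = rat_eval p (s n)" and b: "b = rat_eval q (s n)"
    using common_level[OF assms] .
  show ?thesis
  proof (cases "coprime p q")
    case True
    obtain x y where "x * p + y * q = gcd p q"
      using bezout_coefficients_fst_snd by blast
    then have "rat_eval (x * p + y * q) (s n) = 1"
      using True by simp
    then show ?thesis
      by (intro disjI1 bexI[of _ "rat_eval x (s n)"] bexI[of _ "rat_eval y (s n)"])
        (auto simp: a b mult.commute)
  next
    case False
    \<comment> \<open>The gcd serves, unless p = q = 0: then it is 0, and x is taken
      instead.\<close>
    have "\<exists>d. d dvd p \<and> d dvd q \<and> Polynomial.degree d \<noteq> 0"
    proof (cases "p = 0 \<and> q = 0")
      case True
      then show ?thesis
        by (intro exI[of _ "[:0, 1:]"]) auto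
    next
      case nz: False
      then have "Polynomial.degree (gcd p q) \<noteq> 0"
        using False is_unit_iff_degree[of "gcd p q"] by (auto simp: is_unit_gcd)
      then show ?thesis
        using gcd_dvd1 gcd_dvd2 by blast
    qed
    then obtain d u v where d: "Polynomial.degree d \<noteq> 0" and "p = d * u" "q = d * v"
      unfolding dvd_def by blast
    then have "a = rat_eval d (s n) * rat_eval u (s n)" "b = rat_eval d (s n) * rat_eval v (s n)"
      by (simp_all add: a b)
    moreover have "rat_eval d (s n) \<noteq> 0"
      using d transcendental degree_0 by metis
    ultimately show ?thesis
      using inverse_notin_A[OF d] by blast
  qed
qed

end

section \<open>Choice of the exponent and encoding of complex power series\<close>

lemma countable_UNIV_rat_poly: "countable (UNIV :: rat poly set)"
  by (rule countableI'[of "to_nat \<circ> coeffs"])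
    (auto simp: inj_on_def coeffs_eq_iff)

text \<open>Each pair of a nonzero p and an n excludes only finitely many t, since p has finitely
  many roots and t -> exp (t / 2^n) is injective. There are countably many pairs but uncountably
  many reals.\<close>

lemma exists_transcendental_exponent:
  "\<exists>t :: real. \<forall>n p. rat_eval p (complex_of_real (exp (t / 2 ^ n))) = 0 \<longrightarrow> p = 0"
proof -
  define B where "B = (\<lambda>(p, n). {t. rat_eval p (complex_of_real (exp (t / 2 ^ n))) = 0})"
  have "finite (B (p, n))" if p: "p \<noteq> 0" for p and n :: nat
  proof -
    have "map_poly of_rat p \<noteq> (0 :: complex poly)"
      using p by (simp add: map_poly_eq_0_iff)
    then have "finite {z :: complex. rat_eval p z = 0}"
      unfolding rat_eval_def by (rule poly_roots_finite)
    moreover have "inj (\<lambda>t :: real. complex_of_real (exp (t / 2 ^ n)))"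
      by (auto simp: inj_on_def simp del: of_real_exp)
    ultimately have "finite ((\<lambda>t :: real. complex_of_real (exp (t / 2 ^ n))) -` {z. rat_eval p z = 0})"
      by (rule finite_vimageI)
    then show ?thesis
      by (simp add: B_def vimage_def)
  qed
  then have "countable (\<Union> (B ` ((UNIV - {0}) \<times> UNIV)))"
    using countable_UNIV_rat_poly
    by (intro countable_UN countable_SIGMA countable_Diff) (auto intro: countable_finite)
  then obtain t where "t \<notin> \<Union> (B ` ((UNIV - {0}) \<times> UNIV))"
    using uncountable_UNIV_real by (metis UNIV_eq_I)
  then show ?thesis
    by (auto simp: B_def intro!: exI[of _ t])
qed

lemma real_eqI_rat_less:
  fixes x y :: real
  assumes "\<And>q. of_rat q < x \<longleftrightarrow> of_rat q < y"
  shows "x = y"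
  using assms of_rat_dense by (metis linorder_cases order_less_asym order_less_irrefl)

text \<open>This moves the example to the type \<open>nat set\<close>. A series is determined by the
  rational lower cuts of the real and imaginary parts of its coefficients, that is, by a set of
  triples from a countable type.\<close>

lemma exists_inj_complex_fps_nat_set: "\<exists>\<phi> :: complex fps \<Rightarrow> nat set. inj \<phi>"
proof -
  define C where "C f = {(n :: nat, b, q :: rat).
      of_rat q < (if b then Re (fps_nth f n) else Im (fps_nth f n))}" for f
  have "inj C"
  proof (rule injI)
    fix f g
    assume eq: "C f = C g"
    have C_iff: "(n, b, q) \<in> C f \<longleftrightarrow> of_rat q < (if b then Re (fps_nth f n) else Im (fps_nth f n))"
      for n b q f
      by (simp add: C_def)
    have "Re (fps_nth f n) = Re (fps_nth g n)" "Im (fps_nth f n) = Im (fps_nth g n)" for n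
      using C_iff[of n True _ f] C_iff[of n True _ g] C_iff[of n False _ f] C_iff[of n False _ g]
      by (auto simp: eq intro!: real_eqI_rat_less)
    then show "f = g"
      by (simp add: fps_eq_iff complex_eq_iff)
  qed
  then have "inj (\<lambda>f. to_nat ` C f)"
    by (simp add: inj_on_def inj_image_eq_iff)
  then show ?thesis
    by blast
qed

section \<open>The example over the complex numbers\<close>

theorem proposition3p3:
  shows "\<exists>R :: (nat set) ring.
    domain R \<and> pc_domain R \<and>
    \<not> pre_schreier_domain R \<and> \<not> bezout_domain R \<and> \<not> mip_domain R"
proof -
  obtain t :: real where
    t: "\<And>n p. rat_eval p (complex_of_real (exp (t / 2 ^ n))) = 0 \<Longrightarrow> p = 0"
    using exists_transcendental_exponent by blast
  define s where "s n = complex_of_real (exp (t / 2 ^ n))" for n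
  obtain \<phi> :: "complex fps \<Rightarrow> nat set" where \<phi>: "inj \<phi>"
    using exists_inj_complex_fps_nat_set by blast
  interpret square_root_tower s
  proof
    show "s (Suc n) ^ 2 = s n" for n
      by (simp add: s_def field_simps flip: exp_double of_real_power)
    show "rat_eval p (s n) = 0 \<Longrightarrow> p = 0" for p n
      unfolding s_def by (rule t)
  qed
  interpret pullback \<phi> A
    by unfold_locales (use \<phi> const_A[of 1] A_diff A_mult in auto)
  have "\<i> \<noteq> a / b" if "a \<in> A" "b \<in> A" for a b
  proof -
    \<comment> \<open>All \<open>s n\<close> are real, so quotients of elements of \<open>A\<close>
      are real and differ from \<i>.\<close>
    have "A \<subseteq> \<real>"
      by (auto simp: A_def s_def intro!: rat_eval_Reals)
    then have "a / b \<in> \<real>"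
      using that by (intro Reals_divide) auto
    then show ?thesis
      by (auto simp: complex_is_Real_iff)
  qed
  then have "\<not> pre_schreier_domain R" "\<not> bezout_domain R"
    using not_pre_schreier_R[of \<i>] not_bezout_R[of \<i>] by blast+
  moreover have "pc_domain R"
    by (rule pc_domain_R) (rule A_two_generated)
  moreover have "\<not> mip_domain R"
    by (rule not_mip_R[OF M_subset zero_in_M one_notin_M M_diff M_mult M_inverse_mod M_not_principal])
  ultimately show ?thesis
    using domain_R by blast
qed

end
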